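(* Let $\mathcal{H}$ be a real Hilbert space and let $f:\mathcal{H}\to\left]-\infty,+\infty\right]$ be a proper function such that $\mathcal{X}=\{z\in\mathcal{H} : f(z)=\min_{x\in\mathcal{H}} f(x)\}$ is nonempty; put $f_*=\min_{x\in\mathcal{H}} f(x)$. Let $\eta\in\left]0,+\infty\right[$, $\theta_1\in\left[0,1\right[$, and $\eta_t=\eta\,t^{-\theta_1}$ for every $t\in\mathbb{N}^*$. Let $(\theta_2,\xi)\in\mathbb{R}_+^2$ and let $\{\xi_t\}_{t\in\mathbb{N}^*}\subset\mathbb{R}_+$ satisfy $\xi_t\leq\xi\,t^{-\theta_2}$ for every $t\in\mathbb{N}^*$. Let $\{x_t\}_{t\in\mathbb{N}^*}\subset\mathcal{H}$ be modified Fejér monotone with respect to the target function $f$ and $\{(\eta_t,\xi_t)\}_{t\in\mathbb{N}^*}$. Let $T\in\mathbb{N}$, $T\geq 3$. Then $$f(x_T)-f_*\;\leq\;\frac{d(x_1,\mathcal{X})^2}{\eta}\,T^{\theta_1-1}+\frac{\xi\,c_{\theta_2}}{\eta}\,(\log T)^{\mathbf{1}_{\{\theta_2\leq 1\}}}\,T^{\theta_1-\min\{\theta_2,1\}},$$ where $$c_{\theta_2}=\begin{cases}5+\dfrac{2}{1-\theta_2} & \text{if }\theta_2<1,\\[1ex] 9 & \text{if }\theta_2=1,\\[1ex] \dfrac{2^{\theta_2}+3\theta_2-1}{\theta_2-1} & \text{if }\theta_2>1.\end{cases}$$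
   Context: $\mathbb{R}_+$ is the set of non-negative reals and $\mathbb{N}^*=\mathbb{N}\setminus\{0\}$. $d(x,S)=\inf_{x'\in S}\|x-x'\|$. $\operatorname{dom} f=\{x\in\mathcal{H}: f(x)<+\infty\}$; $f$ is proper if it never takes the value $-\infty$ and $\operatorname{dom} f\neq\emptyset$. No convexity of $f$ is assumed. The exponent $\mathbf{1}_{\{\theta_2\leq 1\}}$ equals $1$ if $\theta_2\leq1$ and $0$ otherwise; $\log$ is the natural logarithm. Definition: a sequence $\{x_t\}_{t\in\mathbb{N}^*}\subset\mathcal{H}$ is modified Fejér monotone with respect to the target function $f$ and the sequence $\{(\eta_t,\xi_t)\}_{t\in\mathbb{N}^*}$ in $\mathbb{R}_+^2$ if for every $t\in\mathbb{N}^*$ and every $x\in\operatorname{dom} f$, $$\|x_{t+1}-x\|^2\leq\|x_t-x\|^2-\eta_t\,(f(x_t)-f(x))+\xi_t .$$ (When $\eta_t>0$ this inequality forces $x_t\in\operatorname{dom} f$.) *)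

theory Defs
  imports "HOL-Analysis.Analysis"
begin

definition eff_dom :: "('a \<Rightarrow> ereal) \<Rightarrow> 'a set" where
  "eff_dom f = {x. f x < \<infinity>}"

definition proper_fun :: "('a \<Rightarrow> ereal) \<Rightarrow> bool" where
  "proper_fun f \<longleftrightarrow> (\<forall>x. f x \<noteq> -\<infinity>) \<and> eff_dom f \<noteq> {}"

text \<open>The infimum over the whole space is a minimum as soon as this set is nonempty;
  the value \<open>INF x. f x\<close> is then the minimum of \<open>f\<close>.\<close>

definition minimizers :: "('a \<Rightarrow> ereal) \<Rightarrow> 'a set" where
  "minimizers f = {z. f z = (INF x. f x)}"

text \<open>Sequences indexed by the positive integers are functions on \<open>nat\<close> whose value at 0
  is irrelevant. The comparison is made in \<open>ereal\<close>: \<open>f x\<close> is finite for a proper \<open>f\<close> and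
  \<open>x\<close> in its domain, so no difference of infinities occurs, and for \<open>\<eta> t > 0\<close> the
  inequality fails whenever \<open>f (u t) = \<infinity>\<close>. For \<open>\<eta> t = 0\<close> the convention
  \<open>0 * \<infinity> = 0\<close> applies.\<close>

definition modified_Fejer ::
  "('a::real_normed_vector \<Rightarrow> ereal) \<Rightarrow> (nat \<Rightarrow> real) \<Rightarrow> (nat \<Rightarrow> real) \<Rightarrow> (nat \<Rightarrow> 'a) \<Rightarrow> bool" where
  "modified_Fejer f \<eta> \<xi> u \<longleftrightarrow>
     (\<forall>t\<ge>1. 0 \<le> \<eta> t \<and> 0 \<le> \<xi> t) \<and>
     (\<forall>t\<ge>1. \<forall>x\<in>eff_dom f.
        ereal ((norm (u (t + 1) - x))\<^sup>2)
          \<le> ereal ((norm (u t - x))\<^sup>2) - ereal (\<eta> t) * (f (u t) - f x) + ereal (\<xi> t))"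

definition c_const :: "real \<Rightarrow> real" where
  "c_const \<theta> =
     (if \<theta> < 1 then 5 + 2 / (1 - \<theta>)
      else if \<theta> = 1 then 9
      else (2 powr \<theta> + 3 * \<theta> - 1) / (\<theta> - 1))"

end

theory Submission
  imports Defs
begin

text \<open>
  Write \<open>\<Delta>\<^sub>t\<close> for the gap \<open>f x\<^sub>t - f\<^sub>*\<close>. Summing the Fejer inequality at a minimizer
  bounds the average of the weighted gaps \<open>\<eta>\<^sub>t \<Delta>\<^sub>t\<close> over the whole run, but the claim concerns
  the last of them. To pass from the average to the last term, use that the Fejer inequality
  holds at every point of the domain, in particular at the earlier iterate \<open>x\<^bsub>T-k\<^esub>\<close>. Summed from
  \<open>T - k\<close> to \<open>T\<close>, where the initial distance is zero, it yields
  \<open>(\<Sum>t=T-k..T. \<eta>\<^sub>t (f x\<^sub>t - f x\<^bsub>T-k\<^esub>)) \<le> (\<Sum>t=T-k..T. \<xi>\<^sub>t)\<close>. As the step sizes decrease, the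
  left side dominates the sum of the differences of the weighted gaps. Hence the average of the
  last \<open>k\<close> weighted gaps exceeds the average of the last \<open>k + 1\<close> by at most the sum of
  the last \<open>k + 1\<close> errors divided by \<open>k (k + 1)\<close>. The coefficients \<open>1 / k - 1 / (k + 1)\<close>
  telescope (lemma \<open>head_le_average_plus_errors\<close>), and the outcome is lemma
  \<open>modified_Fejer_last_iterate\<close>:
  \<open>\<eta>\<^sub>T \<Delta>\<^sub>T \<le> \<parallel>x\<^sub>1 - z\<parallel>\<^sup>2 / T + \<xi>\<^sub>T + (\<Sum>j=1..<T. \<xi>\<^bsub>T-j\<^esub> / j)\<close> for every minimizer \<open>z\<close>.

  It remains to estimate the errors for \<open>\<xi>\<^sub>t = t\<^bsup>-\<theta>\<^esup>\<close>. In the convolution of \<open>t\<^bsup>-\<theta>\<^esup>\<close> with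
  \<open>1 / j\<close>, one of \<open>t\<close> and \<open>j = T - t\<close> is at least \<open>T / 2\<close>, so the sum is at most
  \<open>2 / T\<close> times a partial sum of \<open>t\<^bsup>-\<theta>\<^esup>\<close> plus \<open>2\<^bsup>\<theta>\<^esup> T\<^bsup>-\<theta>\<^esup>\<close> times a harmonic sum. Elementary
  bounds for these two sums, together with \<open>1 \<le> ln T\<close> (the reason for \<open>T \<ge> 3\<close>), give exactly the
  constants of the theorem (lemma \<open>error_sum_le_c_const\<close>).
\<close>

section \<open>From averages to the first term\<close>

text \<open>
  The hypothesis bounds \<open>k\<close> times the amount by which the average \<open>A\<^sub>k\<close> of \<open>v 0, \<dots>, v (k - 1)\<close>
  exceeds \<open>v k\<close>, that is \<open>k (k + 1) (A\<^sub>k - A\<^bsub>k+1\<^esub>)\<close>, so \<open>v 0 = A\<^sub>1\<close> exceeds \<open>A\<^sub>n\<close> by at most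
  \<open>\<Sum>k=1..<n. (\<Sum>j\<le>k. e j) / (k (k + 1))\<close>. Exchanging the two sums makes the coefficient of
  \<open>e j\<close> equal to \<open>1 / j - 1 / n\<close>, or \<open>1 - 1 / n\<close> for \<open>j = 0\<close>. The part \<open>- 1 / n\<close> is kept
  inside the average because it cancels the errors of the telescoped sum over the whole run.
\<close>

lemma head_le_average_plus_errors:
  fixes v e :: "nat \<Rightarrow> real"
  assumes "1 \<le> n"
    and "\<And>k. 1 \<le> k \<Longrightarrow> k < n \<Longrightarrow> (\<Sum>j<k. v j - v k) \<le> (\<Sum>j\<le>k. e j)"
  shows "v 0 \<le> (\<Sum>j<n. v j - e j) / real n + e 0 + (\<Sum>j=1..<n. e j / real j)"
  using assms
proof (induction n rule: nat_induct_at_least)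
  case base
  then show ?case by simp
next
  case (Suc n)
  define V where "V = (\<Sum>j<n. v j)"
  define E where "E = (\<Sum>j<n. e j)"
  have n: "real n > 0" using Suc.hyps by simp
  have IH: "v 0 \<le> (V - E) / n + e 0 + (\<Sum>j=1..<n. e j / real j)"
    using Suc.IH Suc.prems by (simp add: V_def E_def sum_subtractf)
  have "V - n * v n \<le> E + e n"
    using Suc.prems[of n] Suc.hyps by (simp add: V_def E_def sum_subtractf lessThan_Suc_atMost[symmetric])
  then have "0 \<le> (E + e n - (V - n * v n)) / (n * (n + 1))"
    by simp
  also have "\<dots> = (V + v n - (E + e n)) / (n + 1) + e n / n - (V - E) / n"
    using n by (simp add: divide_simps add_pos_pos less_imp_neq[symmetric]) (simp add: algebra_simps)
  finally show ?case
    using IH Suc.hyps by (simp add: V_def E_def sum_subtractf add.commute)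
qed

section \<open>Consequences of the Fejer inequality\<close>

text \<open>
  A positive step size keeps the iterates in the domain: with \<open>f (u t) = \<infinity>\<close> the right side
  of the Fejer inequality would be \<open>-\<infinity>\<close>. This is what makes an iterate an admissible
  comparison point later.
\<close>

lemma modified_Fejer_real:
  fixes u :: "nat \<Rightarrow> 'a::real_normed_vector"
  assumes "proper_fun f" "modified_Fejer f \<eta> \<xi> u" "t \<ge> 1" "\<eta> t > 0"
  shows "u t \<in> eff_dom f"
    and "y \<in> eff_dom f \<Longrightarrow> \<eta> t * (real_of_ereal (f (u t)) - real_of_ereal (f y))
      \<le> (norm (u t - y))\<^sup>2 - (norm (u (t + 1) - y))\<^sup>2 + \<xi> t"
proof -
  have step: "ereal ((norm (u (t + 1) - y))\<^sup>2)
      \<le> ereal ((norm (u t - y))\<^sup>2) - ereal (\<eta> t) * (f (u t) - f y) + ereal (\<xi> t)"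
    if "y \<in> eff_dom f" for y
    using assms that by (auto simp: modified_Fejer_def)
  have fin: "\<exists>r. f y = ereal r" if "y \<in> eff_dom f" for y
    using assms(1) that by (cases "f y") (auto simp: proper_fun_def eff_dom_def)
  show dom: "u t \<in> eff_dom f"
  proof (rule ccontr)
    assume "u t \<notin> eff_dom f"
    then have inf: "f (u t) = \<infinity>" by (simp add: eff_dom_def)
    obtain y where y: "y \<in> eff_dom f" using assms(1) by (auto simp: proper_fun_def)
    then show False using step[OF y] fin[OF y] inf assms(4) by auto
  qed
  show "\<eta> t * (real_of_ereal (f (u t)) - real_of_ereal (f y))
      \<le> (norm (u t - y))\<^sup>2 - (norm (u (t + 1) - y))\<^sup>2 + \<xi> t" if "y \<in> eff_dom f"
    using step[OF that] fin[OF that] fin[OF dom] by auto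
qed

text \<open>
  The index runs backwards from \<open>T\<close> so that the sums have the shape required by
  \<open>head_le_average_plus_errors\<close>.
\<close>

lemma modified_Fejer_telescope:
  fixes u :: "nat \<Rightarrow> 'a::real_normed_vector"
  assumes f: "proper_fun f" and u: "modified_Fejer f \<eta> \<xi> u"
    and pos: "\<And>t. t \<ge> 1 \<Longrightarrow> \<eta> t > 0" and y: "y \<in> eff_dom f"
  shows "k < T \<Longrightarrow>
    (\<Sum>j\<le>k. \<eta> (T - j) * (real_of_ereal (f (u (T - j))) - real_of_ereal (f y)))
      \<le> (norm (u (T - k) - y))\<^sup>2 + (\<Sum>j\<le>k. \<xi> (T - j))"
proof -
  have "(\<Sum>j\<le>k. \<eta> (T - j) * (real_of_ereal (f (u (T - j))) - real_of_ereal (f y)))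
      \<le> (norm (u (T - k) - y))\<^sup>2 - (norm (u (T + 1) - y))\<^sup>2 + (\<Sum>j\<le>k. \<xi> (T - j))"
    if "k < T" for k
    using that
  proof (induction k)
    case 0
    then show ?case using modified_Fejer_real(2)[OF f u _ pos y, of T] by simp
  next
    case (Suc k)
    then have "T - Suc k + 1 = T - k" "T - Suc k \<ge> 1" by simp_all
    then show ?case
      using modified_Fejer_real(2)[OF f u _ pos y, of "T - Suc k"] Suc by simp
  qed
  then show "?thesis" if "k < T"
    using that by (smt (verit) zero_le_power2)
qed

text \<open>
  The last weighted gap is controlled through \<open>head_le_average_plus_errors\<close>, applied to the
  gaps in reversed order. Its hypothesis comes from comparison with the iterate \<open>u (T - k)\<close>,
  and its average from comparison with \<open>z\<close>.
\<close>

lemma modified_Fejer_last_iterate: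
  fixes u :: "nat \<Rightarrow> 'a::real_normed_vector"
  assumes f: "proper_fun f" and u: "modified_Fejer f \<eta> \<xi> u"
    and pos: "\<And>t. t \<ge> 1 \<Longrightarrow> \<eta> t > 0"
    and decr: "\<And>s t. 1 \<le> s \<Longrightarrow> s \<le> t \<Longrightarrow> \<eta> t \<le> \<eta> s"
    and z: "z \<in> eff_dom f" "\<And>y. f z \<le> f y" and T: "T \<ge> 1"
  shows "\<eta> T * (real_of_ereal (f (u T)) - real_of_ereal (f z))
    \<le> (norm (u 1 - z))\<^sup>2 / real T + \<xi> T + (\<Sum>j=1..<T. \<xi> (T - j) / real j)"
proof -
  define F where "F y = real_of_ereal (f y)" for y
  define v where "v j = \<eta> (T - j) * (F (u (T - j)) - F z)" for j
  have dom: "u t \<in> eff_dom f" if "t \<ge> 1" for t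
    using modified_Fejer_real(1)[OF f u that pos] that by simp
  have gap: "F z \<le> F (u t)" if "t \<ge> 1" for t
    using z(1) z(2)[of "u t"] f dom[OF that]
    by (cases "f z"; cases "f (u t)") (auto simp: F_def eff_dom_def proper_fun_def)
  have "(\<Sum>j<k. v j - v k) \<le> (\<Sum>j\<le>k. \<xi> (T - j))" if "1 \<le> k" "k < T" for k
  proof -
    have "v j - v k \<le> \<eta> (T - j) * (F (u (T - j)) - F (u (T - k)))" if "j < k" for j
    proof -
      \<comment> \<open>Here the step sizes must not increase: the gap at the earlier time \<open>T - k\<close> is
        nonnegative, so the weight at \<open>T - j\<close>, which is no larger, does not increase the product.\<close>
      have "\<eta> (T - j) * (F (u (T - k)) - F z) \<le> v k"
        unfolding v_def using decr[of "T - k" "T - j"] gap[of "T - k"] that \<open>k < T\<close>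
        by (intro mult_right_mono) auto
      then show ?thesis by (simp add: v_def algebra_simps)
    qed
    then have "(\<Sum>j<k. v j - v k) \<le> (\<Sum>j<k. \<eta> (T - j) * (F (u (T - j)) - F (u (T - k))))"
      by (intro sum_mono) auto
    \<comment> \<open>The additional term \<open>j = k\<close> vanishes.\<close>
    also have "\<dots> = (\<Sum>j\<le>k. \<eta> (T - j) * (F (u (T - j)) - F (u (T - k))))"
      by (simp add: lessThan_Suc_atMost[symmetric])
    also have "\<dots> \<le> (\<Sum>j\<le>k. \<xi> (T - j))"
      using modified_Fejer_telescope[OF f u pos dom, of "T - k" k T] that by (simp add: F_def)
    finally show ?thesis .
  qed
  then have "v 0 \<le> (\<Sum>j<T. v j - \<xi> (T - j)) / T + \<xi> (T - 0) + (\<Sum>j=1..<T. \<xi> (T - j) / real j)"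
    using T by (intro head_le_average_plus_errors)
  moreover have "(\<Sum>j<T. v j - \<xi> (T - j)) \<le> (norm (u 1 - z))\<^sup>2"
    using modified_Fejer_telescope[OF f u pos z(1), of "T - 1" T] T
    by (simp add: sum_subtractf v_def F_def lessThan_Suc_atMost[symmetric])
  then have "(\<Sum>j<T. v j - \<xi> (T - j)) / T \<le> (norm (u 1 - z))\<^sup>2 / T"
    by (simp add: divide_right_mono)
  ultimately show ?thesis by (simp add: v_def F_def)
qed

section \<open>Estimates for power-law errors\<close>

lemma sum_inverse_le_ln:
  assumes "n \<ge> 1"
  shows "(\<Sum>t=1..n. 1 / real t) \<le> 1 + ln (real n)"
  using assms
proof (induction n rule: nat_induct_at_least)
  case base
  then show ?case by simp
next
  case (Suc n)
  have "ln (real n) - ln (real (Suc n)) \<le> (real n - real (Suc n)) / real (Suc n)"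
    using Suc.hyps by (intro ln_diff_le) auto
  also have "\<dots> = - (1 / real (Suc n))" by simp
  finally show ?case using Suc.IH by simp
qed

text \<open>
  The right side is \<open>1\<close> plus the integral of \<open>t\<^bsup>-\<theta>\<^esup>\<close> over the interval from \<open>1\<close> to \<open>n\<close>;
  in this form the bound covers divergent and convergent series alike.
\<close>

lemma sum_powr_le:
  fixes \<theta> :: real
  assumes "n \<ge> 1" "0 \<le> \<theta>" "\<theta> \<noteq> 1"
  shows "(\<Sum>t=1..n. real t powr (- \<theta>)) \<le> 1 + (real n powr (1 - \<theta>) - 1) / (1 - \<theta>)"
  using assms(1)
proof (induction n rule: nat_induct_at_least)
  case base
  then show ?case by simp
next
  case (Suc n)
  have "\<exists>z::real. n < z \<and> z < real (Suc n) \<and>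
      real (Suc n) powr (1 - \<theta>) / (1 - \<theta>) - real n powr (1 - \<theta>) / (1 - \<theta>)
      = (real (Suc n) - real n) * z powr (- \<theta>)"
  proof (rule MVT2)
    fix x :: real assume "n \<le> x"
    then show "((\<lambda>x::real. x powr (1 - \<theta>) / (1 - \<theta>)) has_real_derivative x powr (- \<theta>)) (at x)"
      using Suc.hyps assms(3) by (auto intro!: derivative_eq_intros)
  qed simp
  then obtain z :: real where z: "n < z" "z < real (Suc n)"
      "real (Suc n) powr (1 - \<theta>) / (1 - \<theta>) - real n powr (1 - \<theta>) / (1 - \<theta>) = z powr (- \<theta>)"
    by auto
  have "real (Suc n) powr (- \<theta>) \<le> z powr (- \<theta>)"
    using z Suc.hyps assms(2) by (intro powr_mono2') auto
  then show ?case using Suc.IH z(3) by (simp add: diff_divide_distrib)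
qed

text \<open>
  Each term is at most one of the two summands on the right: \<open>1 / j \<le> 2 / T\<close> if \<open>j \<ge> T / 2\<close>, and
  \<open>(T - j)\<^bsup>-\<theta>\<^esup> \<le> (T / 2)\<^bsup>-\<theta>\<^esup>\<close> otherwise. Adding both terms everywhere, instead of
  cutting the sum at \<open>T / 2\<close>, avoids rounding of the midpoint.
\<close>

lemma convolution_sum_le:
  fixes \<theta> :: real
  assumes "T \<ge> 1" "0 \<le> \<theta>"
  shows "(\<Sum>j=1..<T. real (T - j) powr (- \<theta>) / real j)
    \<le> 2 / real T * (\<Sum>t=1..T. real t powr (- \<theta>))
      + 2 powr \<theta> * real T powr (- \<theta>) * (1 + ln (real T))"
proof -
  have "real (T - j) powr (- \<theta>) / real j
      \<le> 2 / real T * real (T - j) powr (- \<theta>) + 2 powr \<theta> * real T powr (- \<theta>) * (1 / real j)"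
    if j: "j \<in> {1..<T}" for j
  proof (cases "real j \<ge> real T / 2")
    case True
    then have "1 / real j \<le> 2 / real T"
      using j assms by (simp add: field_simps)
    then have "(1 / real j) * real (T - j) powr (- \<theta>) \<le> 2 / real T * real (T - j) powr (- \<theta>)"
      by (intro mult_right_mono) auto
    moreover have "0 \<le> 2 powr \<theta> * real T powr (- \<theta>) * (1 / real j)" by simp
    ultimately have "(1 / real j) * real (T - j) powr (- \<theta>)
        \<le> 2 / real T * real (T - j) powr (- \<theta>) + 2 powr \<theta> * real T powr (- \<theta>) * (1 / real j)"
      by linarith
    then show ?thesis by simp
  next
    case False
    then have "real (T - j) powr (- \<theta>) \<le> (real T / 2) powr (- \<theta>)"
      using j assms by (intro powr_mono2') (auto simp: of_nat_diff)
    also have "\<dots> = 2 powr \<theta> * real T powr (- \<theta>)"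
      by (simp add: powr_divide powr_minus field_simps)
    finally have "real (T - j) powr (- \<theta>) * (1 / real j)
        \<le> 2 powr \<theta> * real T powr (- \<theta>) * (1 / real j)"
      by (intro mult_right_mono) auto
    moreover have "0 \<le> 2 / real T * real (T - j) powr (- \<theta>)" by simp
    ultimately have "real (T - j) powr (- \<theta>) * (1 / real j)
        \<le> 2 / real T * real (T - j) powr (- \<theta>) + 2 powr \<theta> * real T powr (- \<theta>) * (1 / real j)"
      by linarith
    then show ?thesis by simp
  qed
  then have "(\<Sum>j=1..<T. real (T - j) powr (- \<theta>) / real j)
      \<le> (\<Sum>j=1..<T. 2 / real T * real (T - j) powr (- \<theta>)
          + 2 powr \<theta> * real T powr (- \<theta>) * (1 / real j))"
    by (rule sum_mono)
  also have "\<dots> = 2 / real T * (\<Sum>j=1..<T. real (T - j) powr (- \<theta>))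
      + 2 powr \<theta> * real T powr (- \<theta>) * (\<Sum>j=1..<T. 1 / real j)"
    by (simp only: sum.distrib sum_distrib_left)
  also have "(\<Sum>j=1..<T. real (T - j) powr (- \<theta>)) = (\<Sum>t=1..<T. real t powr (- \<theta>))"
    by (rule sum.reindex_bij_witness[of _ "\<lambda>t. T - t" "\<lambda>t. T - t"]) auto
  also have "2 / real T * (\<Sum>t=1..<T. real t powr (- \<theta>))
      + 2 powr \<theta> * real T powr (- \<theta>) * (\<Sum>j=1..<T. 1 / real j)
      \<le> 2 / real T * (\<Sum>t=1..T. real t powr (- \<theta>))
      + 2 powr \<theta> * real T powr (- \<theta>) * (\<Sum>j=1..T. 1 / real j)"
    by (intro add_mono mult_left_mono sum_mono2) auto
  also have "\<dots> \<le> 2 / real T * (\<Sum>t=1..T. real t powr (- \<theta>))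
      + 2 powr \<theta> * real T powr (- \<theta>) * (1 + ln (real T))"
    using sum_inverse_le_ln[OF assms(1)] by (intro add_mono mult_left_mono) auto
  finally show ?thesis .
qed

lemma one_le_ln:
  assumes "(T::nat) \<ge> 3"
  shows "1 \<le> ln (real T)"
proof -
  have "exp 1 \<le> (3::real)" by (rule exp_le)
  also have "3 \<le> real T" using assms by simp
  finally show ?thesis by (subst ln_ge_iff) (use assms in auto)
qed

text \<open>
  The cases differ in which part of \<open>convolution_sum_le\<close> dominates. For \<open>\<theta> < 1\<close> the partial sum
  has order \<open>T\<^bsup>1-\<theta>\<^esup>\<close>, so the harmonic part brings the logarithm; for \<open>\<theta> = 1\<close> both parts
  have order \<open>ln T / T\<close>; for \<open>\<theta> > 1\<close> the partial sum is bounded, and the logarithm is absorbed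
  by \<open>T\<^bsup>1-\<theta>\<^esup>\<close> at the price of a factor \<open>1 / (\<theta> - 1)\<close>.
\<close>

lemma error_sum_le_c_const:
  fixes \<theta> :: real
  assumes T: "T \<ge> 3" and \<theta>: "0 \<le> \<theta>"
  shows "real T powr (- \<theta>) + (\<Sum>j=1..<T. real (T - j) powr (- \<theta>) / real j)
    \<le> c_const \<theta> * ln (real T) ^ of_bool (\<theta> \<le> 1) * real T powr (- min \<theta> 1)"
proof -
  define L where "L = ln (real T)"
  define P where "P = real T powr (- \<theta>)"
  define S where "S = (\<Sum>t=1..T. real t powr (- \<theta>))"
  have L: "L \<ge> 1" using one_le_ln[OF T] by (simp add: L_def)
  have P: "P > 0" using T by (simp add: P_def)
  have T0: "real T > 0" using T by simp
  have TP: "real T powr (1 - \<theta>) = real T * P"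
    using T by (simp add: P_def powr_diff powr_minus field_simps)
  have conv: "P + (\<Sum>j=1..<T. real (T - j) powr (- \<theta>) / real j)
      \<le> P + 2 / real T * S + 2 powr \<theta> * P * (1 + L)"
    using convolution_sum_le[of T \<theta>] T \<theta> by (simp add: P_def S_def L_def)
  consider "\<theta> < 1" | "\<theta> = 1" | "\<theta> > 1" by linarith
  then have "P + 2 / real T * S + 2 powr \<theta> * P * (1 + L)
      \<le> c_const \<theta> * L ^ of_bool (\<theta> \<le> 1) * real T powr (- min \<theta> 1)"
  proof cases
    case 1
    have "S \<le> 1 + (real T * P - 1) / (1 - \<theta>)"
      using sum_powr_le[of T \<theta>] T \<theta> 1 by (simp add: S_def TP)
    also have "\<dots> \<le> real T * P / (1 - \<theta>)"
      using 1 \<theta> by (simp add: diff_divide_distrib)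
    finally have "2 / real T * S \<le> 2 / real T * (real T * P / (1 - \<theta>))"
      by (intro mult_left_mono) auto
    also have "\<dots> = 2 / (1 - \<theta>) * P" using T by simp
    also have "\<dots> \<le> 2 / (1 - \<theta>) * P * L"
      using 1 P L by (simp add: mult_le_cancel_left1 divide_right_mono)
    finally have S: "2 / real T * S \<le> 2 / (1 - \<theta>) * P * L" .
    have "2 powr \<theta> \<le> 2 powr (1::real)" using 1 by (intro powr_mono) auto
    then have "2 powr \<theta> * P * (1 + L) \<le> 2 * P * (1 + L)"
      using P L by (intro mult_right_mono) auto
    moreover have "3 * P \<le> 3 * P * L" using P L by simp
    ultimately have "P + 2 / real T * S + 2 powr \<theta> * P * (1 + L)
        \<le> 5 * P * L + 2 / (1 - \<theta>) * P * L"
      using S by (simp add: algebra_simps)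
    also have "\<dots> = c_const \<theta> * L ^ of_bool (\<theta> \<le> 1) * real T powr (- min \<theta> 1)"
      using 1 by (simp add: c_const_def P_def algebra_simps)
    finally show ?thesis .
  next
    case 2
    have P1: "P = 1 / real T" using 2 T by (simp add: P_def powr_minus field_simps)
    have "S \<le> 1 + L"
      using sum_inverse_le_ln[of T] T 2 by (simp add: S_def L_def powr_minus field_simps)
    then have "2 / real T * S \<le> 2 / real T * (1 + L)"
      by (intro mult_left_mono) auto
    also have "\<dots> = 2 * P * (1 + L)" by (simp add: P1)
    finally have "P + 2 / real T * S + 2 powr \<theta> * P * (1 + L) \<le> 5 * P + 4 * P * L"
      using 2 by (simp add: algebra_simps)
    also have "\<dots> \<le> 9 * L * P" using P L by simp
    also have "\<dots> = c_const \<theta> * L ^ of_bool (\<theta> \<le> 1) * real T powr (- min \<theta> 1)"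
      using 2 by (simp add: c_const_def P_def)
    finally show ?thesis .
  next
    case 3
    define s where "s = \<theta> - 1"
    have s: "s > 0" using 3 by (simp add: s_def)
    define Q where "Q = real T powr (- s)"
    have PQ: "P = Q / real T" using T TP by (simp add: s_def Q_def)
    have Q: "0 < Q" "Q \<le> 1"
      using T s powr_mono[of "- s" 0 "real T"] by (auto simp: Q_def)
    have "S \<le> 1 + (Q - 1) / (- s)"
      using sum_powr_le[of T \<theta>] T \<theta> 3 by (simp add: S_def Q_def s_def)
    also have "\<dots> \<le> (1 + s) / s" using s Q by (simp add: field_simps)
    finally have S: "S \<le> (1 + s) / s" .
    \<comment> \<open>From \<open>1 + L \<le> 2 L\<close> and \<open>2 w \<le> exp w\<close> at \<open>w = s L\<close> it follows that
      \<open>T\<^bsup>-s\<^esup> (1 + ln T) \<le> 1 / s\<close>.\<close>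
    have "2 * (s * L) \<le> exp (s * L)"
    proof -
      have "1 + s * L + (s * L)\<^sup>2 / 2 \<le> exp (s * L)"
        using s L by (intro exp_lower_Taylor_quadratic) auto
      moreover have "0 \<le> (s * L - 1)\<^sup>2" by simp
      ultimately show ?thesis by (simp add: power2_eq_square algebra_simps)
    qed
    moreover have "s * (1 + L) \<le> 2 * (s * L)" using s L by (simp add: distrib_left)
    ultimately have "s * (1 + L) \<le> exp (s * L)" by linarith
    then have "(1 + L) / exp (s * L) \<le> 1 / s"
      using s by (simp add: divide_le_eq le_divide_eq mult.commute)
    moreover have "Q = 1 / exp (s * L)"
      using T by (simp add: Q_def L_def powr_def exp_minus field_simps)
    ultimately have "Q * (1 + L) \<le> 1 / s" by simp
    then have "2 powr \<theta> * (Q * (1 + L)) \<le> 2 powr \<theta> * (1 / s)"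
      by (intro mult_left_mono) auto
    then have "Q + 2 * S + 2 powr \<theta> * (Q * (1 + L)) \<le> 1 + 2 * ((1 + s) / s) + 2 powr \<theta> * (1 / s)"
      using S Q by linarith
    also have "\<dots> = (2 powr \<theta> + 3 * (1 + s) - 1) / s"
      using s by (simp add: field_simps)
    also have "\<dots> = c_const \<theta>"
      using 3 by (simp add: c_const_def s_def)
    finally have "(Q + 2 * S + 2 powr \<theta> * (Q * (1 + L))) / real T \<le> c_const \<theta> / real T"
      by (intro divide_right_mono) auto
    then show ?thesis
      using 3 T by (simp add: PQ add_divide_distrib powr_minus divide_inverse algebra_simps)
  qed
  then show ?thesis using conv by (simp add: P_def L_def)
qed

section \<open>The convergence rate\<close>

text \<open>
  The distance to a set need not be attained, so a bound that holds for each point of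
  the set is transferred to the infimum.
\<close>

lemma le_infdist_power2:
  fixes A :: "'a::metric_space set"
  assumes "A \<noteq> {}" "\<And>a. a \<in> A \<Longrightarrow> C \<le> (dist x a)\<^sup>2"
  shows "C \<le> (infdist x A)\<^sup>2"
proof (cases "C \<le> 0")
  case True
  then show ?thesis by (meson order_trans zero_le_power2)
next
  case False
  have "sqrt C \<le> infdist x A"
    unfolding infdist_notempty[OF assms(1)]
    using assms by (intro cINF_greatest) (auto intro: real_le_lsqrt)
  then have "(sqrt C)\<^sup>2 \<le> (infdist x A)\<^sup>2"
    using False by (intro power_mono) auto
  then show ?thesis using False by simp
qed

theorem theorem2p5:
  fixes f :: "'a::{real_inner, complete_space} \<Rightarrow> ereal"
    and \<eta> \<theta>\<^sub>1 \<theta>\<^sub>2 \<xi> :: real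
    and \<eta>s \<xi>s :: "nat \<Rightarrow> real"
    and x :: "nat \<Rightarrow> 'a"
    and T :: nat
  assumes "proper_fun f"
    and "minimizers f \<noteq> {}"
    and "\<eta> > 0"
    and "0 \<le> \<theta>\<^sub>1" and "\<theta>\<^sub>1 < 1"
    and "\<And>t. t \<ge> 1 \<Longrightarrow> \<eta>s t = \<eta> * real t powr (- \<theta>\<^sub>1)"
    and "\<theta>\<^sub>2 \<ge> 0" and "\<xi> \<ge> 0"
    and "\<And>t. t \<ge> 1 \<Longrightarrow> 0 \<le> \<xi>s t"
    and "\<And>t. t \<ge> 1 \<Longrightarrow> \<xi>s t \<le> \<xi> * real t powr (- \<theta>\<^sub>2)"
    and "modified_Fejer f \<eta>s \<xi>s x"
    and "T \<ge> 3"
  shows "f (x T) - (INF z. f z)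
    \<le> ereal ((infdist (x 1) (minimizers f))\<^sup>2 / \<eta> * real T powr (\<theta>\<^sub>1 - 1)
        + \<xi> * c_const \<theta>\<^sub>2 / \<eta> * ln (real T) ^ of_bool (\<theta>\<^sub>2 \<le> 1)
            * real T powr (\<theta>\<^sub>1 - min \<theta>\<^sub>2 1))"
proof -
  have \<eta>s: "\<eta>s t = \<eta> * real t powr (- \<theta>\<^sub>1)" if "t \<ge> 1" for t by (rule assms(6)[OF that])
  have pos: "\<eta>s t > 0" if "t \<ge> 1" for t using \<eta>s[OF that] that assms(3) by simp
  have decr: "\<eta>s t \<le> \<eta>s s" if "1 \<le> s" "s \<le> t" for s t
    using that assms(3,4) by (auto simp: \<eta>s intro!: mult_left_mono powr_mono2')
  define F where "F y = real_of_ereal (f y)" for y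
  define m where "m = real_of_ereal (INF z. f z)"
  define R where "R = c_const \<theta>\<^sub>2 * ln (real T) ^ of_bool (\<theta>\<^sub>2 \<le> 1) * real T powr (- min \<theta>\<^sub>2 1)"
  have T1: "T \<ge> 1" using assms(12) by simp
  have T0: "real T > 0" using T1 by simp
  have min: "z \<in> eff_dom f" "f z = (INF z. f z)" if "z \<in> minimizers f" for z
  proof -
    show z: "f z = (INF z. f z)" using that by (simp add: minimizers_def)
    obtain y where "f y < \<infinity>" using assms(1) by (auto simp: proper_fun_def eff_dom_def)
    moreover have "f z \<le> f y" unfolding z by (rule INF_lower) simp
    ultimately show "z \<in> eff_dom f" by (auto simp: eff_dom_def)
  qed
  have fin: "f y = ereal (F y)" if "y \<in> eff_dom f" for y
    using assms(1) that by (cases "f y") (auto simp: F_def proper_fun_def eff_dom_def)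
  have errors: "\<xi>s T + (\<Sum>j=1..<T. \<xi>s (T - j) / real j) \<le> \<xi> * R"
  proof -
    have "\<xi>s T + (\<Sum>j=1..<T. \<xi>s (T - j) / real j)
        \<le> \<xi> * real T powr (- \<theta>\<^sub>2) + (\<Sum>j=1..<T. \<xi> * real (T - j) powr (- \<theta>\<^sub>2) / real j)"
      by (intro add_mono sum_mono divide_right_mono assms(10)) (use T1 in auto)
    also have "\<dots> = \<xi> * (real T powr (- \<theta>\<^sub>2) + (\<Sum>j=1..<T. real (T - j) powr (- \<theta>\<^sub>2) / real j))"
      by (simp add: sum_distrib_left algebra_simps)
    also have "\<dots> \<le> \<xi> * R"
      unfolding R_def using assms(7,8,12) by (intro mult_left_mono error_sum_le_c_const)
    finally show ?thesis .
  qed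
  \<comment> \<open>The last-iterate bound is solved for the squared distance before the minimizer is varied.\<close>
  have "(\<eta>s T * (F (x T) - m) - \<xi> * R) * real T \<le> (infdist (x 1) (minimizers f))\<^sup>2"
  proof (rule le_infdist_power2[OF assms(2)])
    fix z assume z: "z \<in> minimizers f"
    have "f z \<le> f y" for y unfolding min(2)[OF z] by (rule INF_lower) simp
    from modified_Fejer_last_iterate[OF assms(1,11) pos decr min(1)[OF z] this T1]
    have "\<eta>s T * (F (x T) - m) \<le> (norm (x 1 - z))\<^sup>2 / T + \<xi> * R"
      using errors min(2)[OF z] by (simp add: F_def m_def)
    then show "(\<eta>s T * (F (x T) - m) - \<xi> * R) * real T \<le> (dist (x 1) z)\<^sup>2"
      using T0 by (simp add: dist_norm field_simps)
  qed
  then have "\<eta>s T * (F (x T) - m) \<le> (infdist (x 1) (minimizers f))\<^sup>2 / T + \<xi> * R"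
    using T0 by (simp add: field_simps)
  \<comment> \<open>The factor is the inverse of the last step size.\<close>
  then have "(\<eta>s T * (F (x T) - m)) * (real T powr \<theta>\<^sub>1 / \<eta>)
      \<le> ((infdist (x 1) (minimizers f))\<^sup>2 / T + \<xi> * R) * (real T powr \<theta>\<^sub>1 / \<eta>)"
    using assms(3) by (intro mult_right_mono) auto
  also have "(\<eta>s T * (F (x T) - m)) * (real T powr \<theta>\<^sub>1 / \<eta>) = F (x T) - m"
    using assms(3) T0 by (simp add: \<eta>s[OF T1] powr_minus field_simps)
  also have "((infdist (x 1) (minimizers f))\<^sup>2 / T + \<xi> * R) * (real T powr \<theta>\<^sub>1 / \<eta>)
      = (infdist (x 1) (minimizers f))\<^sup>2 / \<eta> * real T powr (\<theta>\<^sub>1 - 1)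
        + \<xi> * c_const \<theta>\<^sub>2 / \<eta> * ln (real T) ^ of_bool (\<theta>\<^sub>2 \<le> 1)
            * real T powr (\<theta>\<^sub>1 - min \<theta>\<^sub>2 1)"
    using T0 by (simp add: R_def powr_diff powr_minus divide_inverse algebra_simps)
  finally have bound: "F (x T) - m \<le> (infdist (x 1) (minimizers f))\<^sup>2 / \<eta> * real T powr (\<theta>\<^sub>1 - 1)
        + \<xi> * c_const \<theta>\<^sub>2 / \<eta> * ln (real T) ^ of_bool (\<theta>\<^sub>2 \<le> 1)
            * real T powr (\<theta>\<^sub>1 - min \<theta>\<^sub>2 1)" .
  obtain z where z: "z \<in> minimizers f" using assms(2) by blast
  have "(INF z. f z) = ereal m" using fin[OF min(1)[OF z]] unfolding min(2)[OF z] F_def m_def .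
  moreover have "f (x T) = ereal (F (x T))"
    using modified_Fejer_real(1)[OF assms(1,11) T1 pos[OF T1]] by (rule fin)
  ultimately show ?thesis using bound by simp
qed

end
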